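(* Suppose that $\sum_{i=1}^N q_i=\mu(\Omega)$ and that $\lambda_1(\mathbf M_1)<\lambda_1(\mathbf M_2)<\cdots<\lambda_1(\mathbf M_N)$. Let $\bm\sigma^*$ be the optimal flux defined in the context, $\psi:=\sum_{i=1}^m\mu_i|\bm\sigma_i^*|^2\in L^1(\Omega)$, and let $\alpha_0=+\infty$ and $\alpha_1,\dots,\alpha_N$ be defined from $\psi$ as in the context. Consider the problem $$\text{maximize}\quad \int_\Omega\sum_{j=1}^N\frac{\theta_j}{\lambda_1(\mathbf M_j)}\,\psi\,d\mathbf x\quad\text{over }\bm\theta\in\mathcal T.\qquad(P)$$ If $\bm\theta^*=(\theta_1^*,\dots,\theta_N^* )\in\mathcal T$ is an optimal solution of $(P)$, then for each $k=1,\dots,N$: $$\operatorname{ess\,supp}\theta_k^*\subseteq\{\mathbf x\in\Omega:\alpha_k\le\psi(\mathbf x)\le\alpha_{k-1}\},\qquad \theta_k^*=1\ \text{a.e. on }\{\mathbf x\in\Omega:\alpha_k<\psi(\mathbf x)<\alpha_{k-1}\}.$$ Conversely, any $\bm\theta^*\in\mathcal T$ satisfying these conditions for every $k=1,\dots,N$ is an optimal solution of $(P)$.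
   Context: Setting. $\Omega\subseteq\mathbb R^d$ is open and bounded, $\mu$ is the $d$-dimensional Lebesgue measure, $N,m\ge1$. $\mathbf M_1,\dots,\mathbf M_N$ are symmetric positive definite $d\times d$ real matrices, and $\lambda_1(\mathbf M)$ denotes the smallest eigenvalue of a symmetric matrix $\mathbf M$. $q_1,\dots,q_N\ge 0$ are prescribed amounts, $f_1,\dots,f_m\in H^{-1}(\Omega)$, and $\mu_1,\dots,\mu_m>0$ are weights. Let $K=\{\bm\theta\in[0,1]^N:\sum_{i=1}^N\theta_i=1\}$, and $\mathcal T=\{\bm\theta\in L^\infty(\Omega;K):\int_\Omega\theta_i\,d\mathbf x=q_i,\ i=1,\dots,N\}$. For $\bm\theta\in K$ let $\lambda_-(\bm\theta)>0$ be defined by $\frac1{\lambda_-(\bm\theta)}=\sum_{i=1}^N\frac{\theta_i}{\lambda_1(\mathbf M_i)}$. Let $\mathcal S=\{\bm\sigma=(\bm\sigma_1,\dots,\bm\sigma_m)\in L^2(\Omega;\mathbb R^d)^m:-\mathrm{div}\,\bm\sigma_i=f_i,\ i=1,\dots,m\}$ and $$H(\bm\theta,\bm\sigma)=\sum_{i=1}^m\mu_i\int_\Omega\frac{|\bm\sigma_i|^2}{\lambda_-(\bm\theta)}\,d\mathbf x,\qquad \bm\theta\in\mathcal T,\ \bm\sigma\in\mathcal S.$$ A saddle point of $H$ is a pair $(\bm\theta^*,\bm\sigma^* )\in\mathcal T\times\mathcal S$ with $H(\bm\theta,\bm\sigma^* )\le H(\bm\theta^*,\bm\sigma^* )\le H(\bm\theta^*,\bm\sigma)$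 for all $\bm\theta\in\mathcal T,\bm\sigma\in\mathcal S$. By the classical saddle-point theorem, saddle points exist, and their set has the form $\mathcal T^*\times\{\bm\sigma^*\}$ for a unique $\bm\sigma^*\in\mathcal S$, called the optimal flux. Distribution function: $\lambda_\psi(\alpha)=\mu(\{\mathbf x\in\Omega:\psi(\mathbf x)>\alpha\})$ for $\alpha\ge0$. For $k=1,\dots,N$, $$\alpha_k:=\min\Big\{\alpha\ge0:\lambda_\psi(\alpha)\le\sum_{i=1}^kq_i\Big\},$$ with $\alpha_0:=+\infty$. (If the set is empty, which can happen only when $q_1=\dots=q_k=0$ and $\psi$ is essentially unbounded, put $\alpha_k=+\infty$.) One has $\alpha_{k+1}\le\alpha_k$ and $\alpha_N=0$. The inclusion $\operatorname{ess\,supp}g\subseteq E$ for a measurable function $g$ and measurable set $E$ means $g=0$ a.e. on $\Omega\setminus E$. *)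

theory Defs
  imports "HOL-Analysis.Analysis"
begin

section \<open>Matrices\<close>

definition symmetric_pos_def :: "real^'d^'d \<Rightarrow> bool" where
  "symmetric_pos_def A \<longleftrightarrow> transpose A = A \<and> (\<forall>v. v \<noteq> 0 \<longrightarrow> v \<bullet> (A *v v) > 0)"

definition is_eigenvalue :: "real^'d^'d \<Rightarrow> real \<Rightarrow> bool" where
  "is_eigenvalue A c \<longleftrightarrow> (\<exists>v. v \<noteq> 0 \<and> A *v v = c *\<^sub>R v)"

text \<open>Only meant for symmetric matrices, which have a least real eigenvalue.\<close>
definition lambda1 :: "real^'d^'d \<Rightarrow> real" where
  "lambda1 A = (LEAST c. is_eigenvalue A c)"


section \<open>Test functions, Sobolev spaces and the divergence\<close>

text \<open>Functions on \<open>\<Omega>\<close> are represented by total functions; only their values on \<open>\<Omega>\<close>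
  matter, since all measurability and integrals refer to \<^term>\<open>lebesgue_on \<Omega>\<close>.  Elements of
  Lebesgue spaces are represented by individual functions rather than by equivalence classes.\<close>

definition grad :: "(real^'d \<Rightarrow> real) \<Rightarrow> real^'d \<Rightarrow> real^'d" where
  "grad \<phi> x = (\<chi> i. frechet_derivative \<phi> (at x) (axis i 1))"

fun times_differentiable :: "nat \<Rightarrow> (real^'d \<Rightarrow> real) \<Rightarrow> bool" where
  "times_differentiable 0 \<phi> \<longleftrightarrow> True"
| "times_differentiable (Suc n) \<phi> \<longleftrightarrow>
     (\<forall>x. \<phi> differentiable (at x)) \<and> (\<forall>i. times_differentiable n (\<lambda>x. grad \<phi> x $ i))"

text \<open>Differentiability of all iterated partial derivatives entails their continuity, so this is
  the space of smooth functions with compact support in \<open>\<Omega>\<close>.\<close>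
definition test_functions :: "(real^'d) set \<Rightarrow> (real^'d \<Rightarrow> real) set" where
  "test_functions \<Omega> = {\<phi>. (\<forall>n. times_differentiable n \<phi>)
     \<and> compact (closure {x. \<phi> x \<noteq> 0}) \<and> closure {x. \<phi> x \<noteq> 0} \<subseteq> \<Omega>}"

definition L2 :: "(real^'d) set \<Rightarrow> (real^'d \<Rightarrow> 'b::euclidean_space) set" where
  "L2 \<Omega> = {u. u \<in> borel_measurable (lebesgue_on \<Omega>)
     \<and> integrable (lebesgue_on \<Omega>) (\<lambda>x. (norm (u x))\<^sup>2)}"

definition L2_norm :: "(real^'d) set \<Rightarrow> (real^'d \<Rightarrow> 'b::euclidean_space) \<Rightarrow> real" where
  "L2_norm \<Omega> u = sqrt (LINT x|lebesgue_on \<Omega>. (norm (u x))\<^sup>2)"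

definition weak_grad :: "(real^'d) set \<Rightarrow> (real^'d \<Rightarrow> real) \<Rightarrow> (real^'d \<Rightarrow> real^'d) \<Rightarrow> bool" where
  "weak_grad \<Omega> u G \<longleftrightarrow> (\<forall>\<phi>\<in>test_functions \<Omega>. \<forall>i.
     (LINT x|lebesgue_on \<Omega>. u x * (grad \<phi> x $ i)) = - (LINT x|lebesgue_on \<Omega>. (G x $ i) * \<phi> x))"

text \<open>The graph of the weak gradient on \<open>H10 \<Omega>\<close>, the closure of the test functions in the Sobolev
  space of \<open>L2\<close> functions with weak gradient in \<open>L2\<close>.\<close>
definition H10_graph :: "(real^'d) set \<Rightarrow> ((real^'d \<Rightarrow> real) \<times> (real^'d \<Rightarrow> real^'d)) set" where
  "H10_graph \<Omega> = {(u, G). u \<in> L2 \<Omega> \<and> G \<in> L2 \<Omega> \<and> weak_grad \<Omega> u G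
     \<and> (\<exists>\<phi> :: nat \<Rightarrow> real^'d \<Rightarrow> real. (\<forall>n. \<phi> n \<in> test_functions \<Omega>)
          \<and> (\<lambda>n. L2_norm \<Omega> (\<lambda>x. \<phi> n x - u x)) \<longlonglongrightarrow> 0
          \<and> (\<lambda>n. L2_norm \<Omega> (\<lambda>x. grad (\<phi> n) x - G x)) \<longlonglongrightarrow> 0)}"

definition H10 :: "(real^'d) set \<Rightarrow> (real^'d \<Rightarrow> real) set" where
  "H10 \<Omega> = Domain (H10_graph \<Omega>)"

text \<open>The dual of \<open>H10 \<Omega>\<close> with its Sobolev norm; the bound forces a functional to agree on
  functions that are equal almost everywhere.\<close>
definition H_minus1 :: "(real^'d) set \<Rightarrow> ((real^'d \<Rightarrow> real) \<Rightarrow> real) set" where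
  "H_minus1 \<Omega> = {f.
     (\<forall>u\<in>H10 \<Omega>. \<forall>v\<in>H10 \<Omega>. f (\<lambda>x. u x + v x) = f u + f v)
     \<and> (\<forall>c. \<forall>u\<in>H10 \<Omega>. f (\<lambda>x. c * u x) = c * f u)
     \<and> (\<exists>C. \<forall>(u, G)\<in>H10_graph \<Omega>. \<bar>f u\<bar> \<le> C * sqrt ((L2_norm \<Omega> u)\<^sup>2 + (L2_norm \<Omega> G)\<^sup>2))}"

text \<open>\<open>- div s = f\<close> in \<open>H_minus1 \<Omega>\<close>, tested against all of \<open>H10 \<Omega>\<close>.\<close>
definition neg_div_eq ::
    "(real^'d) set \<Rightarrow> (real^'d \<Rightarrow> real^'d) \<Rightarrow> ((real^'d \<Rightarrow> real) \<Rightarrow> real) \<Rightarrow> bool" where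
  "neg_div_eq \<Omega> s f \<longleftrightarrow> (\<forall>(u, G)\<in>H10_graph \<Omega>. (LINT x|lebesgue_on \<Omega>. s x \<bullet> G x) = f u)"


section \<open>Admissible designs and fluxes, saddle points\<close>

text \<open>Families indexed by \<open>1, ..., N\<close> or \<open>1, ..., m\<close> are functions on \<^typ>\<open>nat\<close> whose values
  outside the index range are irrelevant.\<close>

definition simplexK :: "nat \<Rightarrow> (nat \<Rightarrow> real) set" where
  "simplexK N = {t. (\<forall>i\<in>{1..N}. 0 \<le> t i \<and> t i \<le> 1) \<and> (\<Sum>i=1..N. t i) = 1}"

definition designs :: "(real^'d) set \<Rightarrow> nat \<Rightarrow> (nat \<Rightarrow> real) \<Rightarrow> (real^'d \<Rightarrow> nat \<Rightarrow> real) set" where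
  "designs \<Omega> N q = {\<theta>.
     (\<forall>i\<in>{1..N}. (\<lambda>x. \<theta> x i) \<in> borel_measurable (lebesgue_on \<Omega>))
     \<and> (AE x in lebesgue_on \<Omega>. \<theta> x \<in> simplexK N)
     \<and> (\<forall>i\<in>{1..N}. (LINT x|lebesgue_on \<Omega>. \<theta> x i) = q i)}"

definition lambda_minus :: "nat \<Rightarrow> (nat \<Rightarrow> real^'d^'d) \<Rightarrow> (nat \<Rightarrow> real) \<Rightarrow> real" where
  "lambda_minus N M t = 1 / (\<Sum>i=1..N. t i / lambda1 (M i))"

definition fluxes ::
    "(real^'d) set \<Rightarrow> nat \<Rightarrow> (nat \<Rightarrow> (real^'d \<Rightarrow> real) \<Rightarrow> real) \<Rightarrow> (nat \<Rightarrow> real^'d \<Rightarrow> real^'d) set" where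
  "fluxes \<Omega> m f = {\<sigma>. \<forall>i\<in>{1..m}. \<sigma> i \<in> L2 \<Omega> \<and> neg_div_eq \<Omega> (\<sigma> i) (f i)}"

definition functionalH ::
    "(real^'d) set \<Rightarrow> nat \<Rightarrow> (nat \<Rightarrow> real^'d^'d) \<Rightarrow> nat \<Rightarrow> (nat \<Rightarrow> real)
     \<Rightarrow> (real^'d \<Rightarrow> nat \<Rightarrow> real) \<Rightarrow> (nat \<Rightarrow> real^'d \<Rightarrow> real^'d) \<Rightarrow> real" where
  "functionalH \<Omega> N M m w \<theta> \<sigma> =
     (\<Sum>i=1..m. w i * (LINT x|lebesgue_on \<Omega>. (norm (\<sigma> i x))\<^sup>2 / lambda_minus N M (\<theta> x)))"

definition saddle_point ::
    "(real^'d) set \<Rightarrow> nat \<Rightarrow> (nat \<Rightarrow> real^'d^'d) \<Rightarrow> (nat \<Rightarrow> real) \<Rightarrow> nat \<Rightarrow> (nat \<Rightarrow> real)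
     \<Rightarrow> (nat \<Rightarrow> (real^'d \<Rightarrow> real) \<Rightarrow> real)
     \<Rightarrow> (real^'d \<Rightarrow> nat \<Rightarrow> real) \<Rightarrow> (nat \<Rightarrow> real^'d \<Rightarrow> real^'d) \<Rightarrow> bool" where
  "saddle_point \<Omega> N M q m w f \<theta>s \<sigma>s \<longleftrightarrow>
     \<theta>s \<in> designs \<Omega> N q \<and> \<sigma>s \<in> fluxes \<Omega> m f
     \<and> (\<forall>\<theta>\<in>designs \<Omega> N q. functionalH \<Omega> N M m w \<theta> \<sigma>s \<le> functionalH \<Omega> N M m w \<theta>s \<sigma>s)
     \<and> (\<forall>\<sigma>\<in>fluxes \<Omega> m f. functionalH \<Omega> N M m w \<theta>s \<sigma>s \<le> functionalH \<Omega> N M m w \<theta>s \<sigma>)"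

text \<open>The set of saddle points is a product whose flux factor is a single equivalence class, so
  the optimal flux is the flux component of any saddle point, determined up to null sets.\<close>
definition optimal_flux ::
    "(real^'d) set \<Rightarrow> nat \<Rightarrow> (nat \<Rightarrow> real^'d^'d) \<Rightarrow> (nat \<Rightarrow> real) \<Rightarrow> nat \<Rightarrow> (nat \<Rightarrow> real)
     \<Rightarrow> (nat \<Rightarrow> (real^'d \<Rightarrow> real) \<Rightarrow> real) \<Rightarrow> (nat \<Rightarrow> real^'d \<Rightarrow> real^'d) \<Rightarrow> bool" where
  "optimal_flux \<Omega> N M q m w f \<sigma>s \<longleftrightarrow> (\<exists>\<theta>s. saddle_point \<Omega> N M q m w f \<theta>s \<sigma>s)"


section \<open>Distribution function, thresholds and the maximization problem\<close>

definition distr_fun :: "(real^'d) set \<Rightarrow> (real^'d \<Rightarrow> real) \<Rightarrow> real \<Rightarrow> real" where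
  "distr_fun \<Omega> \<psi> a = measure lebesgue {x\<in>\<Omega>. \<psi> x > a}"

text \<open>The minimum is attained whenever the set is nonempty, because the distribution function is
  nonincreasing and right-continuous.\<close>
definition threshold ::
    "(real^'d) set \<Rightarrow> (real^'d \<Rightarrow> real) \<Rightarrow> (nat \<Rightarrow> real) \<Rightarrow> nat \<Rightarrow> ereal" where
  "threshold \<Omega> \<psi> q k =
     (if k = 0 \<or> \<not> (\<exists>a\<ge>0. distr_fun \<Omega> \<psi> a \<le> (\<Sum>i=1..k. q i)) then \<infinity>
      else ereal (LEAST a. 0 \<le> a \<and> distr_fun \<Omega> \<psi> a \<le> (\<Sum>i=1..k. q i)))"

definition objective ::
    "(real^'d) set \<Rightarrow> nat \<Rightarrow> (nat \<Rightarrow> real^'d^'d) \<Rightarrow> (real^'d \<Rightarrow> real) \<Rightarrow> (real^'d \<Rightarrow> nat \<Rightarrow> real) \<Rightarrow> real"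
  where
  "objective \<Omega> N M \<psi> \<theta> = (LINT x|lebesgue_on \<Omega>. (\<Sum>j=1..N. \<theta> x j / lambda1 (M j)) * \<psi> x)"

definition optimal_design ::
    "(real^'d) set \<Rightarrow> nat \<Rightarrow> (nat \<Rightarrow> real^'d^'d) \<Rightarrow> (nat \<Rightarrow> real) \<Rightarrow> (real^'d \<Rightarrow> real)
     \<Rightarrow> (real^'d \<Rightarrow> nat \<Rightarrow> real) \<Rightarrow> bool" where
  "optimal_design \<Omega> N M q \<psi> \<theta>s \<longleftrightarrow>
     \<theta>s \<in> designs \<Omega> N q \<and> (\<forall>\<theta>\<in>designs \<Omega> N q. objective \<Omega> N M \<psi> \<theta> \<le> objective \<Omega> N M \<psi> \<theta>s)"

definition ess_supp_subset :: "(real^'d) set \<Rightarrow> (real^'d \<Rightarrow> real) \<Rightarrow> (real^'d) set \<Rightarrow> bool" where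
  "ess_supp_subset \<Omega> g E \<longleftrightarrow> (AE x in lebesgue_on \<Omega>. x \<notin> E \<longrightarrow> g x = 0)"

definition threshold_conditions ::
    "(real^'d) set \<Rightarrow> (nat \<Rightarrow> real) \<Rightarrow> (real^'d \<Rightarrow> real) \<Rightarrow> (real^'d \<Rightarrow> nat \<Rightarrow> real) \<Rightarrow> nat \<Rightarrow> bool" where
  "threshold_conditions \<Omega> q \<psi> \<theta> k \<longleftrightarrow>
     ess_supp_subset \<Omega> (\<lambda>x. \<theta> x k)
       {x\<in>\<Omega>. threshold \<Omega> \<psi> q k \<le> ereal (\<psi> x) \<and> ereal (\<psi> x) \<le> threshold \<Omega> \<psi> q (k - 1)}
     \<and> (AE x in lebesgue_on \<Omega>.
          threshold \<Omega> \<psi> q k < ereal (\<psi> x) \<and> ereal (\<psi> x) < threshold \<Omega> \<psi> q (k - 1) \<longrightarrow> \<theta> x k = 1)"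

end

theory Submission
  imports Defs
begin

text \<open>Write \<open>c\<^sub>j = 1 / \<lambda>\<^sub>1(M\<^sub>j)\<close>, a strictly decreasing sequence, and
  \<open>\<Theta>\<^sub>k = \<theta>\<^sub>1 + \<dots> + \<theta>\<^sub>k\<close>.  Summation by parts turns the objective into
  \<open>c\<^sub>N \<integral>\<psi> + (\<Sum>k<N. (c\<^sub>k - c\<^sub>k\<^sub>+\<^sub>1) \<integral>\<Theta>\<^sub>k \<psi>)\<close> with positive weights, where \<open>0 \<le> \<Theta>\<^sub>k \<le> 1\<close>
  and \<open>\<integral>\<Theta>\<^sub>k = q\<^sub>1 + \<dots> + q\<^sub>k\<close>.  By the bathtub principle each term is maximal exactly when
  \<open>\<Theta>\<^sub>k\<close> is 1 above and 0 below the threshold \<open>\<alpha>\<^sub>k\<close>.  All terms can be maximized simultaneously,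
  since the bathtub solutions can be chosen nondecreasing in \<open>k\<close>; hence a design is optimal iff
  every \<open>\<Theta>\<^sub>k\<close> is a bathtub solution, which is a restatement of the threshold conditions.\<close>

section \<open>The least eigenvalue of a positive definite matrix\<close>

text \<open>The form \<open>v \<bullet> (A *v v) - c * (v \<bullet> v)\<close> is nonnegative and
  vanishes at \<open>u\<close>. Moving from \<open>u\<close> by \<open>t\<close> along the residual
  \<open>h = A *v u - c *\<^sub>R u\<close> gives
  \<open>2 * t * (h \<bullet> h) + t\<^sup>2 * p\<close>, which can be nonnegative for
  \<open>t\<close> of both signs only if \<open>h = 0\<close>.\<close>

lemma rayleigh_minimizer_eigenvector:
  fixes A :: "real^'d^'d"
  assumes sym: "transpose A = A"
    and min: "\<And>v. c * (v \<bullet> v) \<le> v \<bullet> (A *v v)"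
    and u: "u \<bullet> (A *v u) = c * (u \<bullet> u)"
  shows "A *v u = c *\<^sub>R u"
proof -
  define h where "h = A *v u - c *\<^sub>R u"
  define p where "p = h \<bullet> (A *v h) - c * (h \<bullet> h)"
  have Auh: "u \<bullet> (A *v h) = h \<bullet> (A *v u)"
    using dot_lmul_matrix[of u A h] sym by (metis inner_commute transpose_matrix_vector)
  have quad: "0 \<le> 2 * t * (h \<bullet> h) + t\<^sup>2 * p" for t
  proof -
    have "0 \<le> (u + t *\<^sub>R h) \<bullet> (A *v (u + t *\<^sub>R h)) - c * ((u + t *\<^sub>R h) \<bullet> (u + t *\<^sub>R h))"
      using min by simp
    also have "\<dots> = 2 * t * (h \<bullet> (A *v u) - c * (h \<bullet> u)) + t\<^sup>2 * p"
      using u Auh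
      by (simp add: p_def matrix_vector_right_distrib matrix_vector_mult_scaleR inner_add_left
          inner_add_right inner_commute[of u h] power2_eq_square algebra_simps)
    also have "h \<bullet> (A *v u) - c * (h \<bullet> u) = h \<bullet> h"
      by (simp add: h_def inner_diff_right)
    finally show ?thesis .
  qed
  have "h \<bullet> h = 0"
  proof (rule ccontr)
    assume "h \<bullet> h \<noteq> 0"
    then have pos: "h \<bullet> h > 0" by simp
    \<comment> \<open>A step short enough for the linear term to dominate:
      \<open>s * p \<le> h \<bullet> h\<close>, so at \<open>t = - s\<close> the quadratic is at
      most \<open>- s * (h \<bullet> h) < 0\<close>. The summand 1 keeps the denominator positive
      when \<open>p = 0\<close>.\<close>
    define s where "s = (h \<bullet> h) / (\<bar>p\<bar> + 1)"
    have "s > 0" using pos by (simp add: s_def)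
    have "s * p \<le> h \<bullet> h"
    proof -
      have "s * p \<le> s * (\<bar>p\<bar> + 1)" using \<open>s > 0\<close> by (intro mult_left_mono) auto
      then show ?thesis by (simp add: s_def)
    qed
    then have "s * (s * p) \<le> s * (h \<bullet> h)" using \<open>s > 0\<close> by (intro mult_left_mono) auto
    moreover have "s * (h \<bullet> h) > 0" using pos \<open>s > 0\<close> by simp
    ultimately show False
      using quad[of "- s"] by (simp add: power2_eq_square algebra_simps)
  qed
  then show ?thesis by (simp add: h_def)
qed

text \<open>By compactness the quadratic form attains its minimum \<open>c\<close> on the unit
  sphere. It is positive, is an eigenvalue by the previous lemma, and bounds every eigenvalue from
  below, so the \<open>LEAST\<close> in \<open>lambda1\<close> really exists and equals
  \<open>c\<close>.\<close>

lemma lambda1_pos: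
  fixes A :: "real^'d^'d"
  assumes A: "symmetric_pos_def A"
  shows "lambda1 A > 0"
proof -
  have cont: "continuous_on (sphere 0 1) (\<lambda>v. v \<bullet> (A *v v))"
    by (intro continuous_intros matrix_vector_mult_linear_continuous_on)
  have "sphere (0::real^'d) 1 \<noteq> {}" by simp
  then obtain u where u: "norm u = 1" and umin: "\<And>v. norm v = 1 \<Longrightarrow> u \<bullet> (A *v u) \<le> v \<bullet> (A *v v)"
    using continuous_attains_inf[OF compact_sphere _ cont] by auto
  define c where "c = u \<bullet> (A *v u)"
  have "u \<noteq> 0" using u by auto
  then have "c > 0" using A by (simp add: c_def symmetric_pos_def_def)
  have min: "c * (v \<bullet> v) \<le> v \<bullet> (A *v v)" for v
  proof (cases "v = 0")
    case False
    have "c \<le> (v /\<^sub>R norm v) \<bullet> (A *v (v /\<^sub>R norm v))"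
      unfolding c_def using False by (intro umin) simp
    also have "\<dots> = (v \<bullet> (A *v v)) / (v \<bullet> v)"
      by (simp add: matrix_vector_mult_scaleR dot_square_norm power2_eq_square field_simps)
    finally show ?thesis using False by (simp add: field_simps)
  qed simp
  have "A *v u = c *\<^sub>R u"
    using A min u by (intro rayleigh_minimizer_eigenvector)
      (auto simp: symmetric_pos_def_def c_def dot_square_norm)
  then have "is_eigenvalue A c" using \<open>u \<noteq> 0\<close> by (auto simp: is_eigenvalue_def)
  moreover have "c \<le> e" if "is_eigenvalue A e" for e
  proof -
    obtain v where "v \<noteq> 0" "A *v v = e *\<^sub>R v" using \<open>is_eigenvalue A e\<close> by (auto simp: is_eigenvalue_def)
    then show ?thesis using min[of v] by simp
  qed
  ultimately have "lambda1 A = c" unfolding lambda1_def by (intro Least_equality)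
  then show ?thesis using \<open>c > 0\<close> by simp
qed


section \<open>The bathtub principle\<close>

text \<open>The values on the level set \<psi> = \<alpha> stay free. An extended real threshold
  covers \<alpha> = \<infinity>, where the condition says that \<open>u\<close> vanishes almost
  everywhere.\<close>

definition bathtub :: "'a measure \<Rightarrow> ('a \<Rightarrow> real) \<Rightarrow> ereal \<Rightarrow> ('a \<Rightarrow> real) \<Rightarrow> bool" where
  "bathtub M \<psi> \<alpha> u \<longleftrightarrow>
     (AE x in M. (\<alpha> < ereal (\<psi> x) \<longrightarrow> u x = 1) \<and> (ereal (\<psi> x) < \<alpha> \<longrightarrow> u x = 0))"

text \<open>Equal masses allow a finite threshold \<open>a\<close> to be subtracted: the gain of
  \<open>v\<close> over \<open>u\<close> is the integral of
  \<open>(v x - u x) * (\<psi> x - a)\<close>, whose integrand is nonnegative because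
  \<open>v\<close> is extremal on either side of \<open>a\<close>. Zero gain makes it vanish almost
  everywhere, so \<open>u\<close> agrees with \<open>v\<close> off the level set.\<close>

lemma (in finite_measure) bathtub_optimal:
  assumes u: "u \<in> borel_measurable M" "AE x in M. 0 \<le> u x \<and> u x \<le> 1"
    and v: "v \<in> borel_measurable M" "AE x in M. 0 \<le> v x \<and> v x \<le> 1"
    and \<psi>: "integrable M \<psi>"
    and eq: "(LINT x|M. u x) = (LINT x|M. v x)"
    and \<alpha>: "\<alpha> \<noteq> -\<infinity>" and bt: "bathtub M \<psi> \<alpha> v"
  shows "(LINT x|M. u x * \<psi> x) \<le> (LINT x|M. v x * \<psi> x)"
    and "(LINT x|M. u x * \<psi> x) = (LINT x|M. v x * \<psi> x) \<Longrightarrow> bathtub M \<psi> \<alpha> u"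
proof -
  note [measurable] = u(1) v(1) borel_measurable_integrable[OF \<psi>]
  have intu: "integrable M u" and intv: "integrable M v"
    using u v by (auto intro!: integrable_const_bound[where B=1])
  have intup: "integrable M (\<lambda>x. u x * \<psi> x)"
    using u by (intro Bochner_Integration.integrable_bound[OF \<psi>])
      (auto simp: abs_mult mult_left_le_one_le)
  have intvp: "integrable M (\<lambda>x. v x * \<psi> x)"
    using v by (intro Bochner_Integration.integrable_bound[OF \<psi>])
      (auto simp: abs_mult mult_left_le_one_le)
  have "(LINT x|M. u x * \<psi> x) \<le> (LINT x|M. v x * \<psi> x)
      \<and> ((LINT x|M. u x * \<psi> x) = (LINT x|M. v x * \<psi> x) \<longrightarrow> bathtub M \<psi> \<alpha> u)"
  proof (cases \<alpha>)
    case (real a)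
    define g where "g x = (v x - u x) * (\<psi> x - a)" for x
    have g_eq: "g = (\<lambda>x. v x * \<psi> x - u x * \<psi> x - a * (v x - u x))"
      by (auto simp: g_def algebra_simps)
    have intg: "integrable M g"
      unfolding g_eq using intu intv intup intvp by auto
    have lintg: "(LINT x|M. g x) = (LINT x|M. v x * \<psi> x) - (LINT x|M. u x * \<psi> x)"
      unfolding g_eq using intu intv intup intvp eq by simp
    have pos: "AE x in M. 0 \<le> g x"
      using bt[unfolded bathtub_def] u(2)
    proof eventually_elim
      case (elim x)
      then show ?case
        by (cases "\<psi> x" a rule: linorder_cases)
          (auto simp: g_def real zero_le_mult_iff mult_le_0_iff)
    qed
    have "0 \<le> (LINT x|M. g x)" using pos by (rule integral_nonneg_AE)
    moreover have "bathtub M \<psi> \<alpha> u" if "(LINT x|M. u x * \<psi> x) = (LINT x|M. v x * \<psi> x)"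
    proof -
      have "AE x in M. g x = 0"
        using integral_nonneg_eq_0_iff_AE[OF intg pos] lintg that by simp
      with bt show ?thesis unfolding bathtub_def
        by eventually_elim (auto simp: g_def real)
    qed
    ultimately show ?thesis using lintg by auto
  next
    \<comment> \<open>No threshold can be subtracted here. Instead \<open>v\<close> has mass 0,
      hence so does \<open>u\<close>, and both vanish almost everywhere.\<close>
    case PInf
    have v0: "AE x in M. v x = 0" using bt by (simp add: bathtub_def PInf)
    then have "(LINT x|M. v x) = 0" by (simp add: integral_eq_zero_AE)
    then have u0: "AE x in M. u x = 0"
      using integral_nonneg_eq_0_iff_AE[OF intu] u(2) eq by simp
    have "(LINT x|M. v x * \<psi> x) = 0" "(LINT x|M. u x * \<psi> x) = 0"
      using u0 v0 by (auto intro!: integral_eq_zero_AE)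
    then show ?thesis using u0 by (simp add: bathtub_def PInf)
  qed (use \<alpha> in simp)
  then show "(LINT x|M. u x * \<psi> x) \<le> (LINT x|M. v x * \<psi> x)"
    and "(LINT x|M. u x * \<psi> x) = (LINT x|M. v x * \<psi> x) \<Longrightarrow> bathtub M \<psi> \<alpha> u" by auto
qed

section \<open>Explicit bathtub solutions of prescribed mass\<close>

text \<open>This is the exact range of masses that functions with values in [0,1], equal to 1 above
  and to 0 below \<alpha>, can have on a finite measure space.\<close>

definition fill_level :: "'a measure \<Rightarrow> ('a \<Rightarrow> real) \<Rightarrow> real \<Rightarrow> ereal \<Rightarrow> bool" where
  "fill_level M \<psi> Q \<alpha> \<longleftrightarrow> measure M {x\<in>space M. \<alpha> < ereal (\<psi> x)} \<le> Q
     \<and> Q \<le> measure M {x\<in>space M. \<alpha> \<le> ereal (\<psi> x)}"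

text \<open>The mass not absorbed by the set \<open>\<alpha> < \<psi>\<close> is spread uniformly over the level set
  \<open>\<psi> = \<alpha>\<close>.  On a null level set the value 1 keeps the family monotone in \<open>\<alpha>\<close> and \<open>Q\<close>.\<close>
definition fill :: "'a measure \<Rightarrow> ('a \<Rightarrow> real) \<Rightarrow> real \<Rightarrow> ereal \<Rightarrow> 'a \<Rightarrow> real" where
  "fill M \<psi> Q \<alpha> x = (if \<alpha> < ereal (\<psi> x) then 1 else if ereal (\<psi> x) < \<alpha> then 0
     else if measure M {x\<in>space M. ereal (\<psi> x) = \<alpha>} = 0 then 1
     else (Q - measure M {x\<in>space M. \<alpha> < ereal (\<psi> x)}) / measure M {x\<in>space M. ereal (\<psi> x) = \<alpha>})"

lemma bathtub_fill: "bathtub M \<psi> \<alpha> (fill M \<psi> Q \<alpha>)"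
  by (auto simp: bathtub_def fill_def)

lemma borel_measurable_fill [measurable]:
  assumes [measurable]: "\<psi> \<in> borel_measurable M"
  shows "fill M \<psi> Q \<alpha> \<in> borel_measurable M"
  unfolding fill_def by measurable

context finite_measure
begin

lemma fill_level_split:
  assumes [measurable]: "\<psi> \<in> borel_measurable M"
  shows "measure M {x\<in>space M. \<alpha> \<le> ereal (\<psi> x)} =
    measure M {x\<in>space M. \<alpha> < ereal (\<psi> x)} + measure M {x\<in>space M. ereal (\<psi> x) = \<alpha>}"
proof -
  have "{x\<in>space M. \<alpha> \<le> ereal (\<psi> x)} =
      {x\<in>space M. \<alpha> < ereal (\<psi> x)} \<union> {x\<in>space M. ereal (\<psi> x) = \<alpha>}"
    by (auto simp: less_le)
  then show ?thesis by (simp, subst finite_measure_Union) auto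
qed

lemma fill_bounds:
  assumes "\<psi> \<in> borel_measurable M" "fill_level M \<psi> Q \<alpha>"
  shows "0 \<le> fill M \<psi> Q \<alpha> x" "fill M \<psi> Q \<alpha> x \<le> 1"
proof -
  have pos: "0 < measure M {x\<in>space M. ereal (\<psi> x) = \<alpha>}"
    if "measure M {x\<in>space M. ereal (\<psi> x) = \<alpha>} \<noteq> 0"
    using that by (simp add: less_le)
  show "0 \<le> fill M \<psi> Q \<alpha> x" "fill M \<psi> Q \<alpha> x \<le> 1"
    using assms fill_level_split[OF assms(1), of \<alpha>] pos
    by (auto simp: fill_def fill_level_def divide_le_eq_1)
qed

lemma integral_fill:
  assumes [measurable]: "\<psi> \<in> borel_measurable M" and lev: "fill_level M \<psi> Q \<alpha>"
  shows "(LINT x|M. fill M \<psi> Q \<alpha> x) = Q"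
proof -
  let ?A = "{x\<in>space M. \<alpha> < ereal (\<psi> x)}" and ?B = "{x\<in>space M. ereal (\<psi> x) = \<alpha>}"
  define t where "t = (if measure M ?B = 0 then 1 else (Q - measure M ?A) / measure M ?B)"
  have "(LINT x|M. fill M \<psi> Q \<alpha> x) = (LINT x|M. indicator ?A x + t * indicator ?B x)"
    by (intro Bochner_Integration.integral_cong) (auto simp: fill_def t_def indicator_def)
  also have "\<dots> = measure M ?A + t * measure M ?B"
    by (subst Bochner_Integration.integral_add) (auto simp: integrable_indicator_iff emeasure_eq_measure)
  \<comment> \<open>On a null level set, \<open>fill_level\<close> squeezes \<open>Q\<close> to the
    mass of the strict superlevel set, so the value 1 chosen there costs nothing.\<close>
  also have "\<dots> = Q"
    using lev fill_level_split[OF assms(1), of \<alpha>] by (auto simp: t_def fill_level_def)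
  finally show ?thesis .
qed

text \<open>At equal thresholds a larger mass raises the value on the level set. If
  \<open>\<alpha>' < \<alpha>\<close>, every point has either \<open>\<psi> x < \<alpha>\<close>,
  where the left side is 0, or \<open>\<alpha>' < \<psi> x\<close>, where the right side is
  1.\<close>

lemma fill_mono:
  assumes "\<psi> \<in> borel_measurable M" "fill_level M \<psi> Q \<alpha>" "fill_level M \<psi> Q' \<alpha>'"
    and "Q \<le> Q'" "\<alpha>' \<le> \<alpha>"
  shows "fill M \<psi> Q \<alpha> x \<le> fill M \<psi> Q' \<alpha>' x"
proof (cases "\<alpha>' = \<alpha>")
  case True
  then show ?thesis using \<open>Q \<le> Q'\<close> by (auto simp: fill_def intro!: divide_right_mono)
next
  case False
  show ?thesis
  proof (cases "ereal (\<psi> x) < \<alpha>")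
    case True
    then have "fill M \<psi> Q \<alpha> x = 0" by (simp add: fill_def)
    then show ?thesis using fill_bounds[OF assms(1,3)] by simp
  next
    case False
    then have "\<alpha>' < ereal (\<psi> x)" using \<open>\<alpha>' \<noteq> \<alpha>\<close> \<open>\<alpha>' \<le> \<alpha>\<close> by (metis less_le not_less order_less_le_trans)
    then have "fill M \<psi> Q' \<alpha>' x = 1" by (simp add: fill_def)
    then show ?thesis using fill_bounds[OF assms(1,2)] by simp
  qed
qed

section \<open>Limits of superlevel measures and the least admissible level\<close>

lemma superlevel_tendsto_0:
  fixes \<psi> :: "'a \<Rightarrow> real"
  assumes [measurable]: "\<psi> \<in> borel_measurable M"
  shows "(\<lambda>n. measure M {x\<in>space M. real n < \<psi> x}) \<longlonglongrightarrow> 0"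
proof -
  have "(\<Inter>n. {x\<in>space M. real n < \<psi> x}) = {}"
  proof (intro equals0I)
    fix x assume x: "x \<in> (\<Inter>n. {x\<in>space M. real n < \<psi> x})"
    obtain n where "\<psi> x < real n" using reals_Archimedean2 by blast
    with x show False by (auto dest: spec[of _ n])
  qed
  moreover have "(\<lambda>n. measure M {x\<in>space M. real n < \<psi> x})
      \<longlonglongrightarrow> measure M (\<Inter>n. {x\<in>space M. real n < \<psi> x})"
    by (intro finite_Lim_measure_decseq) (auto simp: decseq_def)
  ultimately show ?thesis by simp
qed

lemma superlevel_right_continuous:
  fixes \<psi> :: "'a \<Rightarrow> real"
  assumes [measurable]: "\<psi> \<in> borel_measurable M"
  shows "(\<lambda>n. measure M {x\<in>space M. a + 1 / real (Suc n) < \<psi> x}) \<longlonglongrightarrow> measure M {x\<in>space M. a < \<psi> x}"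
proof -
  have "(\<Union>n. {x\<in>space M. a + 1 / real (Suc n) < \<psi> x}) = {x\<in>space M. a < \<psi> x}"
  proof (intro equalityI subsetI)
    fix x assume x: "x \<in> {x\<in>space M. a < \<psi> x}"
    then obtain n where "inverse (real (Suc n)) < \<psi> x - a"
      using reals_Archimedean[of "\<psi> x - a"] by auto
    then show "x \<in> (\<Union>n. {x\<in>space M. a + 1 / real (Suc n) < \<psi> x})"
      using x by (auto intro!: exI[of _ n] simp: inverse_eq_divide)
  next
    fix x assume "x \<in> (\<Union>n. {x\<in>space M. a + 1 / real (Suc n) < \<psi> x})"
    then obtain n where "x \<in> space M" "a + 1 / real (Suc n) < \<psi> x" by auto
    moreover have "0 < 1 / real (Suc n)" by simp
    ultimately have "x \<in> space M" "a < \<psi> x" by (simp, linarith)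
    then show "x \<in> {x\<in>space M. a < \<psi> x}" by simp
  qed
  moreover have "incseq (\<lambda>n. {x\<in>space M. a + 1 / real (Suc n) < \<psi> x})"
    unfolding incseq_def
  proof (intro allI impI subsetI)
    fix k l :: nat and x assume "k \<le> l" and x: "x \<in> {x\<in>space M. a + 1 / real (Suc k) < \<psi> x}"
    then have "1 / real (Suc l) \<le> 1 / real (Suc k)" by (intro divide_left_mono) auto
    then show "x \<in> {x\<in>space M. a + 1 / real (Suc l) < \<psi> x}" using x by auto
  qed
  then have "(\<lambda>n. measure M {x\<in>space M. a + 1 / real (Suc n) < \<psi> x})
      \<longlonglongrightarrow> measure M (\<Union>n. {x\<in>space M. a + 1 / real (Suc n) < \<psi> x})"
    by (intro finite_Lim_measure_incseq) auto
  ultimately show ?thesis by simp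
qed

text \<open>The step is \<open>a / real (Suc n)\<close> rather than \<open>1 / real (Suc n)\<close>
  so that the approximating levels remain nonnegative: thresholds are minimal among nonnegative
  levels only.\<close>

lemma superlevel_left_limit:
  fixes \<psi> :: "'a \<Rightarrow> real"
  assumes [measurable]: "\<psi> \<in> borel_measurable M" and "a > 0"
  shows "(\<lambda>n. measure M {x\<in>space M. a - a / real (Suc n) < \<psi> x}) \<longlonglongrightarrow> measure M {x\<in>space M. a \<le> \<psi> x}"
proof -
  have "(\<Inter>n. {x\<in>space M. a - a / real (Suc n) < \<psi> x}) = {x\<in>space M. a \<le> \<psi> x}"
  proof (intro equalityI subsetI)
    fix x assume x: "x \<in> (\<Inter>n. {x\<in>space M. a - a / real (Suc n) < \<psi> x})"
    have "(\<lambda>n. a - a * (1 / real (Suc n))) \<longlonglongrightarrow> a - a * 0"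
      by (intro tendsto_intros LIMSEQ_Suc[OF lim_1_over_n])
    then have "(\<lambda>n. a - a / real (Suc n)) \<longlonglongrightarrow> a" by simp
    then have "a \<le> \<psi> x" by (rule LIMSEQ_le_const2) (use x in \<open>auto intro: less_imp_le\<close>)
    then show "x \<in> {x\<in>space M. a \<le> \<psi> x}" using x by auto
  next
    fix x assume "x \<in> {x\<in>space M. a \<le> \<psi> x}"
    moreover have "a - a / real (Suc n) < a" for n using \<open>a > 0\<close> by simp
    ultimately have "x \<in> space M \<and> a - a / real (Suc n) < \<psi> x" for n
      by (metis (mono_tags, lifting) mem_Collect_eq order_less_le_trans)
    then show "x \<in> (\<Inter>n. {x\<in>space M. a - a / real (Suc n) < \<psi> x})" by blast
  qed
  moreover have "decseq (\<lambda>n. {x\<in>space M. a - a / real (Suc n) < \<psi> x})"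
    unfolding decseq_def
  proof (intro allI impI subsetI)
    fix k l :: nat and x assume "k \<le> l" and x: "x \<in> {x\<in>space M. a - a / real (Suc l) < \<psi> x}"
    then have "a / real (Suc l) \<le> a / real (Suc k)" using \<open>a > 0\<close> by (intro divide_left_mono) auto
    then show "x \<in> {x\<in>space M. a - a / real (Suc k) < \<psi> x}" using x by auto
  qed
  then have "(\<lambda>n. measure M {x\<in>space M. a - a / real (Suc n) < \<psi> x})
      \<longlonglongrightarrow> measure M (\<Inter>n. {x\<in>space M. a - a / real (Suc n) < \<psi> x})"
    by (intro finite_Lim_measure_decseq) auto
  ultimately show ?thesis by simp
qed

text \<open>\<open>LEAST\<close> over the reals means something only if a minimum exists.
  Right-continuity of the distribution function puts the infimum of the admissible levels among
  them.\<close>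

lemma superlevel_least:
  fixes \<psi> :: "'a \<Rightarrow> real"
  assumes [measurable]: "\<psi> \<in> borel_measurable M"
    and ex: "\<exists>a\<ge>0. measure M {x\<in>space M. a < \<psi> x} \<le> Q"
  defines "\<alpha> \<equiv> LEAST a. 0 \<le> a \<and> measure M {x\<in>space M. a < \<psi> x} \<le> Q"
  shows "0 \<le> \<alpha>" "measure M {x\<in>space M. \<alpha> < \<psi> x} \<le> Q"
    and "\<And>a. 0 \<le> a \<Longrightarrow> measure M {x\<in>space M. a < \<psi> x} \<le> Q \<Longrightarrow> \<alpha> \<le> a"
proof -
  define S where "S = {a. 0 \<le> a \<and> measure M {x\<in>space M. a < \<psi> x} \<le> Q}"
  have "S \<noteq> {}" using ex by (auto simp: S_def)
  have bdd: "bdd_below S" by (auto simp: S_def intro: bdd_belowI[of _ 0])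
  have "0 \<le> Inf S" using \<open>S \<noteq> {}\<close> by (intro cInf_greatest) (auto simp: S_def)
  moreover have "measure M {x\<in>space M. Inf S < \<psi> x} \<le> Q"
  proof (rule LIMSEQ_le_const2[OF superlevel_right_continuous[OF assms(1)]],
      intro exI[of _ 0] allI impI)
    fix n
    have "Inf S < Inf S + 1 / real (Suc n)" by simp
    then obtain b where b: "b \<in> S" "b < Inf S + 1 / real (Suc n)"
      using cInf_lessD[OF \<open>S \<noteq> {}\<close>] by blast
    then have "measure M {x\<in>space M. Inf S + 1 / real (Suc n) < \<psi> x} \<le> measure M {x\<in>space M. b < \<psi> x}"
      by (intro finite_measure_mono) auto
    with b show "measure M {x\<in>space M. Inf S + 1 / real (Suc n) < \<psi> x} \<le> Q" by (simp add: S_def)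
  qed
  moreover have least: "Inf S \<le> a" if "0 \<le> a" "measure M {x\<in>space M. a < \<psi> x} \<le> Q" for a
    using that by (intro cInf_lower[OF _ bdd]) (auto simp: S_def)
  moreover have "\<alpha> = Inf S"
    unfolding \<alpha>_def using calculation by (intro Least_equality) auto
  ultimately show "0 \<le> \<alpha>" "measure M {x\<in>space M. \<alpha> < \<psi> x} \<le> Q"
    "\<And>a. 0 \<le> a \<Longrightarrow> measure M {x\<in>space M. a < \<psi> x} \<le> Q \<Longrightarrow> \<alpha> \<le> a" by auto
qed

text \<open>The upper bound on the strict superlevel set is admissibility. For the lower one, levels
  just below a positive minimum are inadmissible, so their superlevel sets have mass above
  \<open>Q\<close>, and the left limit preserves this. At minimum 0 the weak superlevel set is the
  whole space.\<close>

lemma fill_level_least: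
  fixes \<psi> :: "'a \<Rightarrow> real"
  assumes \<psi>[measurable]: "\<psi> \<in> borel_measurable M" and nonneg: "\<And>x. 0 \<le> \<psi> x"
    and Q: "Q \<le> measure M (space M)"
    and ex: "\<exists>a\<ge>0. measure M {x\<in>space M. a < \<psi> x} \<le> Q"
  shows "fill_level M \<psi> Q (ereal (LEAST a. 0 \<le> a \<and> measure M {x\<in>space M. a < \<psi> x} \<le> Q))"
proof -
  define \<alpha> where "\<alpha> = (LEAST a. 0 \<le> a \<and> measure M {x\<in>space M. a < \<psi> x} \<le> Q)"
  note \<alpha> = superlevel_least[OF \<psi> ex, folded \<alpha>_def]
  have "Q \<le> measure M {x\<in>space M. \<alpha> \<le> \<psi> x}"
  proof (cases "\<alpha> = 0")
    case True
    then show ?thesis using Q nonneg by simp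
  next
    case False
    then have "\<alpha> > 0" using \<alpha>(1) by simp
    show ?thesis
    proof (rule LIMSEQ_le_const[OF superlevel_left_limit[OF \<psi> \<open>\<alpha> > 0\<close>]], intro exI[of _ 0] allI impI)
      fix n
      have "0 \<le> \<alpha> - \<alpha> / real (Suc n)" "\<not> \<alpha> \<le> \<alpha> - \<alpha> / real (Suc n)"
        using \<open>\<alpha> > 0\<close> by (auto simp: field_simps)
      then show "Q \<le> measure M {x\<in>space M. \<alpha> - \<alpha> / real (Suc n) < \<psi> x}"
        using \<alpha>(3) by (meson nle_le)
    qed
  qed
  then show ?thesis using \<alpha>(2) by (simp add: fill_level_def \<alpha>_def)
qed

end


section \<open>Nested bathtub problems\<close>

text \<open>Abel summation with the full sum split off: on the simplex that sum is 1, so its term is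
  constant and only the proper partial sums depend on the design.\<close>

lemma sum_by_parts_last:
  fixes c t :: "nat \<Rightarrow> real"
  assumes "N \<ge> 1"
  shows "(\<Sum>j=1..N. t j * c j) =
    c N * (\<Sum>i=1..N. t i) + (\<Sum>k=1..<N. (c k - c (Suc k)) * (\<Sum>i=1..k. t i))"
  using assms
proof (induction N rule: nat_induct_at_least)
  case (Suc n)
  then show ?case by (simp add: algebra_simps)
qed simp

lemma simplexK_partial_sum:
  assumes "t \<in> simplexK N" "k \<le> N"
  shows "0 \<le> (\<Sum>i=1..k. t i)" "(\<Sum>i=1..k. t i) \<le> 1"
proof -
  show "0 \<le> (\<Sum>i=1..k. t i)" using assms by (intro sum_nonneg) (auto simp: simplexK_def)
  have "(\<Sum>i=1..k. t i) \<le> (\<Sum>i=1..N. t i)" using assms by (intro sum_mono2) (auto simp: simplexK_def)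
  then show "(\<Sum>i=1..k. t i) \<le> 1" using assms by (simp add: simplexK_def)
qed

text \<open>Separates the maximization problem from the saddle point: \<psi> is a fixed nonnegative
  integrable function, and the matrices enter through the positive, strictly increasing numbers
  \<open>lambda1 (M i)\<close>.\<close>

locale nested_bathtub =
  fixes \<Omega> :: "(real^'d) set" and N :: nat and M :: "nat \<Rightarrow> real^'d^'d" and q :: "nat \<Rightarrow> real"
    and \<psi> :: "real^'d \<Rightarrow> real"
  assumes \<Omega>: "\<Omega> \<in> lmeasurable" and N: "N \<ge> 1"
    and q_nonneg: "i \<in> {1..N} \<Longrightarrow> 0 \<le> q i"
    and q_total: "(\<Sum>i=1..N. q i) = measure lebesgue \<Omega>"
    and integrable_\<psi>: "integrable (lebesgue_on \<Omega>) \<psi>" and \<psi>_nonneg: "0 \<le> \<psi> x"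
    and lambda1_M_pos: "i \<in> {1..N} \<Longrightarrow> 0 < lambda1 (M i)"
    and lambda1_mono: "strict_mono_on {1..N} (\<lambda>i. lambda1 (M i))"
begin

section \<open>Cumulative amounts and their thresholds\<close>

abbreviation "Q k \<equiv> \<Sum>i=1..k. q i"
abbreviation "\<alpha> \<equiv> threshold \<Omega> \<psi> q"

sublocale finite_measure "lebesgue_on \<Omega>"
  using \<Omega> by (rule finite_measure_lebesgue_on)

lemma measurable_\<psi> [measurable]: "\<psi> \<in> borel_measurable (lebesgue_on \<Omega>)"
  using integrable_\<psi> by (rule borel_measurable_integrable)

lemma measure_\<Omega>: "A \<subseteq> \<Omega> \<Longrightarrow> measure (lebesgue_on \<Omega>) A = measure lebesgue A"
  using \<Omega> by (intro measure_restrict_space) (auto simp: fmeasurableD)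

lemma distr_fun_eq: "distr_fun \<Omega> \<psi> a = measure (lebesgue_on \<Omega>) {x\<in>space (lebesgue_on \<Omega>). a < \<psi> x}"
  by (simp add: distr_fun_def measure_\<Omega>)

lemma Q_mono: "k \<le> l \<Longrightarrow> l \<le> N \<Longrightarrow> Q k \<le> Q l"
  using q_nonneg by (intro sum_mono2) auto

lemma Q_le_total: "k \<le> N \<Longrightarrow> Q k \<le> measure (lebesgue_on \<Omega>) (space (lebesgue_on \<Omega>))"
  using Q_mono[of k N] q_total by (simp add: measure_\<Omega>)

text \<open>Hence for \<open>1 \<le> k \<le> N\<close> the default value \<infinity> of
  \<open>threshold\<close> can occur only when \<open>Q k = 0\<close>.\<close>

lemma Q_pos_level:
  assumes "0 < Q k"
  shows "\<exists>a\<ge>0. distr_fun \<Omega> \<psi> a \<le> Q k"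
proof -
  have "eventually (\<lambda>n. distr_fun \<Omega> \<psi> (real n) < Q k) sequentially"
    using superlevel_tendsto_0[OF measurable_\<psi>] assms unfolding distr_fun_eq by (rule order_tendstoD)
  then obtain n where "distr_fun \<Omega> \<psi> (real n) < Q k"
    by (auto simp: eventually_sequentially)
  then show ?thesis by (intro exI[of _ "real n"]) auto
qed

text \<open>When the threshold is \<infinity>, the cumulative amount is 0 and both superlevel sets
  are empty; otherwise the threshold is the least admissible level.\<close>

lemma fill_level_threshold:
  assumes "k \<le> N"
  shows "fill_level (lebesgue_on \<Omega>) \<psi> (Q k) (\<alpha> k)"
proof (cases "k = 0 \<or> \<not> (\<exists>a\<ge>0. distr_fun \<Omega> \<psi> a \<le> Q k)")
  case True
  then have "Q k = 0" using Q_pos_level[of k] Q_mono[of 0 k] assms by fastforce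
  moreover have "\<alpha> k = \<infinity>" using True by (simp add: threshold_def)
  ultimately show ?thesis by (simp add: fill_level_def)
next
  case False
  then show ?thesis
    using fill_level_least[OF measurable_\<psi> \<psi>_nonneg Q_le_total[OF assms]]
    by (simp add: threshold_def distr_fun_eq)
qed

lemma threshold_0: "\<alpha> 0 = \<infinity>"
  by (simp add: threshold_def)

lemma threshold_nonneg: "0 \<le> \<alpha> k"
  using superlevel_least(1)[OF measurable_\<psi>, of "Q k"]
  by (auto simp: threshold_def distr_fun_eq)

lemma threshold_antimono:
  assumes "k \<le> l" "l \<le> N"
  shows "\<alpha> l \<le> \<alpha> k"
proof (cases "k = 0 \<or> \<not> (\<exists>a\<ge>0. distr_fun \<Omega> \<psi> a \<le> Q k)")
  case True
  then show ?thesis by (simp add: threshold_def)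
next
  case False
  then have ex: "\<exists>a\<ge>0. distr_fun \<Omega> \<psi> a \<le> Q k" by simp
  have ex': "\<exists>a\<ge>0. distr_fun \<Omega> \<psi> a \<le> Q l" using ex Q_mono[OF assms] by force
  note k = superlevel_least[OF measurable_\<psi> ex[unfolded distr_fun_eq]]
  have "(LEAST a. 0 \<le> a \<and> distr_fun \<Omega> \<psi> a \<le> Q l) \<le> (LEAST a. 0 \<le> a \<and> distr_fun \<Omega> \<psi> a \<le> Q k)"
    using superlevel_least(3)[OF measurable_\<psi> ex'[unfolded distr_fun_eq] k(1)] k(2) Q_mono[OF assms]
    by (simp add: distr_fun_eq)
  then show ?thesis using ex ex' False assms by (simp add: threshold_def)
qed

text \<open>The amounts fill \<Omega>, so level 0 is already admissible.\<close>

lemma threshold_N: "\<alpha> N = 0"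
proof -
  have "distr_fun \<Omega> \<psi> 0 \<le> Q N"
    unfolding distr_fun_eq q_total using measure_\<Omega>[of \<Omega>] bounded_measure by simp
  then have "(LEAST a. 0 \<le> a \<and> distr_fun \<Omega> \<psi> a \<le> Q N) = 0"
    by (intro Least_equality) auto
  then show ?thesis using N \<open>distr_fun \<Omega> \<psi> 0 \<le> Q N\<close> by (auto simp: threshold_def zero_ereal_def)
qed

section \<open>Partial sums of designs and the objective\<close>

lemma
  assumes "\<theta> \<in> designs \<Omega> N q"
  shows designs_simplex: "AE x in lebesgue_on \<Omega>. \<theta> x \<in> simplexK N"
    and designs_measurable: "i \<in> {1..N} \<Longrightarrow> (\<lambda>x. \<theta> x i) \<in> borel_measurable (lebesgue_on \<Omega>)"
    and designs_integral: "i \<in> {1..N} \<Longrightarrow> (LINT x|lebesgue_on \<Omega>. \<theta> x i) = q i"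
  using assms by (auto simp: designs_def)

text \<open>Shows that the partial sums are competitors in the bathtub problem of mass
  \<open>Q k\<close>.\<close>

lemma
  assumes \<theta>: "\<theta> \<in> designs \<Omega> N q" and k: "k \<le> N"
  shows partial_measurable: "(\<lambda>x. \<Sum>i=1..k. \<theta> x i) \<in> borel_measurable (lebesgue_on \<Omega>)"
    and partial_bounds: "AE x in lebesgue_on \<Omega>. 0 \<le> (\<Sum>i=1..k. \<theta> x i) \<and> (\<Sum>i=1..k. \<theta> x i) \<le> 1"
    and partial_integral: "(LINT x|lebesgue_on \<Omega>. (\<Sum>i=1..k. \<theta> x i)) = Q k"
    and partial_integrable: "integrable (lebesgue_on \<Omega>) (\<lambda>x. (\<Sum>i=1..k. \<theta> x i) * \<psi> x)"
proof -
  show meas: "(\<lambda>x. \<Sum>i=1..k. \<theta> x i) \<in> borel_measurable (lebesgue_on \<Omega>)"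
    using designs_measurable[OF \<theta>] k by (intro borel_measurable_sum) auto
  show bounds: "AE x in lebesgue_on \<Omega>. 0 \<le> (\<Sum>i=1..k. \<theta> x i) \<and> (\<Sum>i=1..k. \<theta> x i) \<le> 1"
    using designs_simplex[OF \<theta>] by eventually_elim (use simplexK_partial_sum k in auto)
  have "integrable (lebesgue_on \<Omega>) (\<lambda>x. \<theta> x i)" if "i \<in> {1..N}" for i
    using designs_measurable[OF \<theta> that] designs_simplex[OF \<theta>] that
    by (intro integrable_const_bound[where B=1]) (auto simp: simplexK_def)
  then show "(LINT x|lebesgue_on \<Omega>. (\<Sum>i=1..k. \<theta> x i)) = Q k"
    using designs_integral[OF \<theta>] k by (subst Bochner_Integration.integral_sum) (auto intro!: sum.cong)
  show "integrable (lebesgue_on \<Omega>) (\<lambda>x. (\<Sum>i=1..k. \<theta> x i) * \<psi> x)"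
    using bounds meas
    by (intro Bochner_Integration.integrable_bound[OF integrable_\<psi>])
      (auto simp: abs_mult mult_left_le_one_le)
qed

lemma objective_eq:
  assumes \<theta>: "\<theta> \<in> designs \<Omega> N q"
  shows "objective \<Omega> N M \<psi> \<theta> = (LINT x|lebesgue_on \<Omega>. \<psi> x) / lambda1 (M N)
    + (\<Sum>k=1..<N. (1 / lambda1 (M k) - 1 / lambda1 (M (Suc k)))
        * (LINT x|lebesgue_on \<Omega>. (\<Sum>i=1..k. \<theta> x i) * \<psi> x))"
proof -
  let ?c = "\<lambda>j. 1 / lambda1 (M j)"
  have "AE x in lebesgue_on \<Omega>. (\<Sum>j=1..N. \<theta> x j / lambda1 (M j)) * \<psi> x
      = ?c N * \<psi> x + (\<Sum>k=1..<N. (?c k - ?c (Suc k)) * ((\<Sum>i=1..k. \<theta> x i) * \<psi> x))"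
    using designs_simplex[OF \<theta>]
  proof eventually_elim
    case (elim x)
    then have "(\<Sum>j=1..N. \<theta> x j / lambda1 (M j))
        = ?c N + (\<Sum>k=1..<N. (?c k - ?c (Suc k)) * (\<Sum>i=1..k. \<theta> x i))"
      using sum_by_parts_last[OF N, of "\<theta> x" ?c] by (simp add: simplexK_def)
    then show ?case by (simp add: distrib_right sum_distrib_right mult.assoc)
  qed
  then have "objective \<Omega> N M \<psi> \<theta> = (LINT x|lebesgue_on \<Omega>. ?c N * \<psi> x
      + (\<Sum>k=1..<N. (?c k - ?c (Suc k)) * ((\<Sum>i=1..k. \<theta> x i) * \<psi> x)))"
    unfolding objective_def
    by (intro integral_cong_AE)
      (use designs_measurable[OF \<theta>] partial_integrable[OF \<theta>] in
        \<open>auto intro!: borel_measurable_add borel_measurable_sum borel_measurable_times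
          borel_measurable_divide intro: borel_measurable_integrable\<close>)
  also have "\<dots> = ?c N * (LINT x|lebesgue_on \<Omega>. \<psi> x)
    + (\<Sum>k=1..<N. (?c k - ?c (Suc k)) * (LINT x|lebesgue_on \<Omega>. (\<Sum>i=1..k. \<theta> x i) * \<psi> x))"
    using integrable_\<psi> partial_integrable[OF \<theta>]
    by (subst Bochner_Integration.integral_add)
      (auto simp: Bochner_Integration.integral_sum intro!: Bochner_Integration.integrable_sum)
  finally show ?thesis by simp
qed

text \<open>Strict positivity matters for necessity: it lets equality of the objectives be split
  into equality of each term.\<close>

lemma weight_pos: "k \<in> {1..<N} \<Longrightarrow> 0 < 1 / lambda1 (M k) - 1 / lambda1 (M (Suc k))"
  using lambda1_M_pos[of k] lambda1_M_pos[of "Suc k"] strict_mono_onD[OF lambda1_mono, of k "Suc k"]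
  by (auto simp: field_simps)

text \<open>Thresholds decrease in \<open>k\<close>. By the support conditions, all components after
  \<open>k\<close> vanish where \<open>\<psi> x > \<alpha> k\<close>, and all up to \<open>k\<close>
  vanish where \<open>\<psi> x < \<alpha> k\<close>, which gives partial sums 1 and 0. Conversely,
  each component is a difference of consecutive partial sums.\<close>

lemma threshold_conditions_iff_bathtub:
  assumes \<theta>: "\<theta> \<in> designs \<Omega> N q"
  shows "(\<forall>k\<in>{1..N}. threshold_conditions \<Omega> q \<psi> \<theta> k)
    \<longleftrightarrow> (\<forall>k\<in>{1..<N}. bathtub (lebesgue_on \<Omega>) \<psi> (\<alpha> k) (\<lambda>x. \<Sum>i=1..k. \<theta> x i))"
proof
  assume *: "\<forall>k\<in>{1..N}. threshold_conditions \<Omega> q \<psi> \<theta> k"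
  have "AE x in lebesgue_on \<Omega>. \<forall>j\<in>{1..N}. \<theta> x j = 0 \<or> \<alpha> j \<le> ereal (\<psi> x) \<and> ereal (\<psi> x) \<le> \<alpha> (j - 1)"
    using * by (intro AE_ball_countable')
      (auto simp: threshold_conditions_def ess_supp_subset_def elim!: eventually_mono)
  then have ae: "AE x in lebesgue_on \<Omega>. \<theta> x \<in> simplexK N \<and>
      (\<forall>j\<in>{1..N}. \<theta> x j = 0 \<or> \<alpha> j \<le> ereal (\<psi> x) \<and> ereal (\<psi> x) \<le> \<alpha> (j - 1))"
    using designs_simplex[OF \<theta>] by eventually_elim auto
  show "\<forall>k\<in>{1..<N}. bathtub (lebesgue_on \<Omega>) \<psi> (\<alpha> k) (\<lambda>x. \<Sum>i=1..k. \<theta> x i)"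
    unfolding bathtub_def
  proof
    fix k assume k: "k \<in> {1..<N}"
    show "AE x in lebesgue_on \<Omega>. (\<alpha> k < ereal (\<psi> x) \<longrightarrow> (\<Sum>i=1..k. \<theta> x i) = 1)
        \<and> (ereal (\<psi> x) < \<alpha> k \<longrightarrow> (\<Sum>i=1..k. \<theta> x i) = 0)"
      using ae
    proof (eventually_elim, intro conjI impI)
      fix x
      assume x: "\<theta> x \<in> simplexK N \<and>
        (\<forall>j\<in>{1..N}. \<theta> x j = 0 \<or> \<alpha> j \<le> ereal (\<psi> x) \<and> ereal (\<psi> x) \<le> \<alpha> (j - 1))"
      show "(\<Sum>i=1..k. \<theta> x i) = 1" if "\<alpha> k < ereal (\<psi> x)"
      proof -
        have "\<theta> x j = 0" if "j \<in> {1..N} - {1..k}" for j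
        proof -
          have "\<alpha> (j - 1) \<le> \<alpha> k" using that by (intro threshold_antimono) auto
          then show ?thesis using x that \<open>\<alpha> k < ereal (\<psi> x)\<close> by force
        qed
        then have "(\<Sum>i=1..k. \<theta> x i) = (\<Sum>i=1..N. \<theta> x i)" using k by (intro sum.mono_neutral_left) auto
        then show ?thesis using x by (simp add: simplexK_def)
      qed
      show "(\<Sum>i=1..k. \<theta> x i) = 0" if "ereal (\<psi> x) < \<alpha> k"
      proof (intro sum.neutral ballI)
        fix j assume j: "j \<in> {1..k}"
        then have "\<alpha> k \<le> \<alpha> j" using k by (intro threshold_antimono) auto
        then show "\<theta> x j = 0" using x j k \<open>ereal (\<psi> x) < \<alpha> k\<close> by force
      qed
    qed
  qed
next
  assume *: "\<forall>k\<in>{1..<N}. bathtub (lebesgue_on \<Omega>) \<psi> (\<alpha> k) (\<lambda>x. \<Sum>i=1..k. \<theta> x i)"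
  \<comment> \<open>The endpoints are added so that every component lies between two bathtub
    functions: at \<open>k = 0\<close> an empty sum with threshold \<infinity>, at
    \<open>k = N\<close> the full sum 1 with threshold 0 and \<psi> nonnegative.\<close>
  have bt: "bathtub (lebesgue_on \<Omega>) \<psi> (\<alpha> k) (\<lambda>x. \<Sum>i=1..k. \<theta> x i)" if kN: "k \<le> N" for k
  proof -
    consider "k = 0" | "k \<in> {1..<N}" | "k = N" using kN by fastforce
    then show ?thesis
    proof cases
      case 3
      have "AE x in lebesgue_on \<Omega>. (\<Sum>i=1..N. \<theta> x i) = 1"
        using designs_simplex[OF \<theta>] by eventually_elim (simp add: simplexK_def)
      then show ?thesis unfolding bathtub_def 3 threshold_N
        by eventually_elim (use \<psi>_nonneg in \<open>auto simp: not_less[symmetric]\<close>)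
    qed (use * in \<open>auto simp: bathtub_def threshold_0\<close>)
  qed
  show "\<forall>k\<in>{1..N}. threshold_conditions \<Omega> q \<psi> \<theta> k"
  proof
    fix k assume k: "k \<in> {1..N}"
    then obtain l where l: "k = Suc l" "l < N" by (cases k) auto
    have kN: "k \<le> N" and lN: "l \<le> N" using k l by auto
    have "AE x in lebesgue_on \<Omega>.
        (\<not> (\<alpha> k \<le> ereal (\<psi> x) \<and> ereal (\<psi> x) \<le> \<alpha> l) \<longrightarrow> \<theta> x k = 0)
        \<and> (\<alpha> k < ereal (\<psi> x) \<and> ereal (\<psi> x) < \<alpha> l \<longrightarrow> \<theta> x k = 1)"
      using bt[OF kN, unfolded bathtub_def] bt[OF lN, unfolded bathtub_def] designs_simplex[OF \<theta>]
    proof eventually_elim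
      case (elim x)
      \<comment> \<open>Below the band the sum up to \<open>k\<close> is 0, above it the sum up to
        \<open>l\<close> is already 1; either way the increment must vanish. Strictly inside, the
        two sums are 1 and 0.\<close>
      have "(\<Sum>i=1..k. \<theta> x i) = (\<Sum>i=1..l. \<theta> x i) + \<theta> x k" by (simp add: l)
      moreover have "0 \<le> (\<Sum>i=1..l. \<theta> x i)" "(\<Sum>i=1..k. \<theta> x i) \<le> 1"
        using simplexK_partial_sum[OF elim(3)] kN lN by auto
      moreover have "0 \<le> \<theta> x k" using elim(3) k by (auto simp: simplexK_def)
      ultimately show ?case using elim(1,2) by (auto simp: not_le)
    qed
    then show "threshold_conditions \<Omega> q \<psi> \<theta> k"
      unfolding threshold_conditions_def ess_supp_subset_def AE_conj_iff[symmetric]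
      by (rule AE_mp) (auto simp: l(1) intro!: AE_I2)
  qed
qed

text \<open>One design solves all the bathtub problems at once: its components are increments of the
  explicit solutions, nonnegative by \<open>fill_mono\<close>, and their integrals are the
  increments of \<open>Q\<close>.\<close>

lemma ex_bathtub_design:
  "\<exists>\<theta>\<in>designs \<Omega> N q. \<forall>k\<in>{1..<N}. bathtub (lebesgue_on \<Omega>) \<psi> (\<alpha> k) (\<lambda>x. \<Sum>i=1..k. \<theta> x i)"
proof -
  define F where "F k = fill (lebesgue_on \<Omega>) \<psi> (Q k) (\<alpha> k)" for k
  define \<theta> where "\<theta> x i = F i x - F (i - 1) x" for x i
  \<comment> \<open>The convention that the zeroth threshold is \<infinity> starts the telescoping
    sum at 0.\<close>
  have F0: "F 0 x = 0" for x by (simp add: F_def fill_def threshold_0)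
  have partial: "(\<Sum>i=1..k. \<theta> x i) = F k x" for k x
    by (induction k) (auto simp: \<theta>_def F0)
  have meas: "F k \<in> borel_measurable (lebesgue_on \<Omega>)" for k
    unfolding F_def by simp
  have bounds: "0 \<le> F k x" "F k x \<le> 1" if "k \<le> N" for k x
    unfolding F_def using fill_bounds[OF measurable_\<psi> fill_level_threshold[OF that]] by auto
  have int: "integrable (lebesgue_on \<Omega>) (F k)" if "k \<le> N" for k
    using bounds[OF that] meas by (intro integrable_const_bound[where B=1]) auto
  have mono: "F (i - 1) x \<le> F i x" if "i \<in> {1..N}" for i x
    unfolding F_def using that
    by (intro fill_mono fill_level_threshold threshold_antimono Q_mono) auto
  have integral: "(LINT x|lebesgue_on \<Omega>. F k x) = Q k" if "k \<le> N" for k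
    unfolding F_def using fill_level_threshold[OF that] by (intro integral_fill) auto
  \<comment> \<open>A function bounded by 1 whose integral is the full measure of \<Omega> equals 1
    almost everywhere; this makes the components sum to 1.\<close>
  have "AE x in lebesgue_on \<Omega>. F N x = 1"
  proof -
    have int1: "integrable (lebesgue_on \<Omega>) (\<lambda>x. 1 - F N x)" using int[of N] by auto
    have "(LINT x|lebesgue_on \<Omega>. 1 - F N x) = 0"
      using int[of N] integral[of N] by (simp add: q_total[unfolded One_nat_def] measure_\<Omega>)
    then have "AE x in lebesgue_on \<Omega>. 1 - F N x = 0"
      using integral_nonneg_eq_0_iff_AE[OF int1] bounds[of N] by simp
    then show ?thesis by simp
  qed
  then have "AE x in lebesgue_on \<Omega>. \<theta> x \<in> simplexK N"
  proof eventually_elim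
    case (elim x)
    have "0 \<le> \<theta> x i \<and> \<theta> x i \<le> 1" if "i \<in> {1..N}" for i
    proof -
      have "i \<le> N" "i - 1 \<le> N" using that by auto
      then show ?thesis
        using mono[OF that, of x] bounds(2)[of i x] bounds(1)[of "i - 1" x] unfolding \<theta>_def by linarith
    qed
    then show ?case using elim partial[where k=N] by (simp add: simplexK_def)
  qed
  moreover have "(LINT x|lebesgue_on \<Omega>. \<theta> x i) = q i" if "i \<in> {1..N}" for i
  proof -
    have "(LINT x|lebesgue_on \<Omega>. \<theta> x i) = Q i - Q (i - 1)"
    proof -
      have "i \<le> N" "i - 1 \<le> N" using that by auto
      then show ?thesis unfolding \<theta>_def by (simp only: Bochner_Integration.integral_diff int integral)
    qed
    also have "\<dots> = q i" using that by (cases i) auto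
    finally show ?thesis .
  qed
  ultimately have "\<theta> \<in> designs \<Omega> N q"
    using meas by (auto simp: designs_def \<theta>_def[abs_def])
  then show ?thesis
    by (intro bexI[of _ \<theta>]) (simp_all only: partial, simp add: F_def bathtub_fill)
qed

text \<open>All designs share the cumulative amounts \<open>Q k\<close>, so their partial sums have
  equal mass and the bathtub principle compares them.\<close>

lemma partial_bathtub_optimal:
  assumes \<theta>: "\<theta> \<in> designs \<Omega> N q" and \<theta>': "\<theta>' \<in> designs \<Omega> N q" and k: "k \<in> {1..<N}"
    and bt: "bathtub (lebesgue_on \<Omega>) \<psi> (\<alpha> k) (\<lambda>x. \<Sum>i=1..k. \<theta> x i)"
  shows "(LINT x|lebesgue_on \<Omega>. (\<Sum>i=1..k. \<theta>' x i) * \<psi> x)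
      \<le> (LINT x|lebesgue_on \<Omega>. (\<Sum>i=1..k. \<theta> x i) * \<psi> x)"
    and "(LINT x|lebesgue_on \<Omega>. (\<Sum>i=1..k. \<theta>' x i) * \<psi> x)
      = (LINT x|lebesgue_on \<Omega>. (\<Sum>i=1..k. \<theta> x i) * \<psi> x)
      \<Longrightarrow> bathtub (lebesgue_on \<Omega>) \<psi> (\<alpha> k) (\<lambda>x. \<Sum>i=1..k. \<theta>' x i)"
proof -
  have kN: "k \<le> N" using k by simp
  have "\<alpha> k \<noteq> -\<infinity>" using threshold_nonneg[of k] by auto
  note opt = bathtub_optimal[OF partial_measurable[OF \<theta>' kN] partial_bounds[OF \<theta>' kN]
      partial_measurable[OF \<theta> kN] partial_bounds[OF \<theta> kN] integrable_\<psi> _ this bt]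
  show "(LINT x|lebesgue_on \<Omega>. (\<Sum>i=1..k. \<theta>' x i) * \<psi> x)
      \<le> (LINT x|lebesgue_on \<Omega>. (\<Sum>i=1..k. \<theta> x i) * \<psi> x)"
    by (rule opt(1)) (simp only: partial_integral[OF \<theta> kN] partial_integral[OF \<theta>' kN])
  show "bathtub (lebesgue_on \<Omega>) \<psi> (\<alpha> k) (\<lambda>x. \<Sum>i=1..k. \<theta>' x i)"
    if "(LINT x|lebesgue_on \<Omega>. (\<Sum>i=1..k. \<theta>' x i) * \<psi> x)
      = (LINT x|lebesgue_on \<Omega>. (\<Sum>i=1..k. \<theta> x i) * \<psi> x)"
    using that by (intro opt(2)) (simp only: partial_integral[OF \<theta> kN] partial_integral[OF \<theta>' kN])
qed

text \<open>Sufficiency holds term by term in \<open>objective_eq\<close>. For necessity, an optimal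
  design is compared with a simultaneous bathtub design \<eta>, which dominates it in each
  term.\<close>

lemma optimal_design_iff:
  assumes \<theta>: "\<theta> \<in> designs \<Omega> N q"
  shows "optimal_design \<Omega> N M q \<psi> \<theta> \<longleftrightarrow> (\<forall>k\<in>{1..N}. threshold_conditions \<Omega> q \<psi> \<theta> k)"
  unfolding threshold_conditions_iff_bathtub[OF \<theta>]
proof
  let ?I = "\<lambda>\<theta> k. LINT x|lebesgue_on \<Omega>. (\<Sum>i=1..k. \<theta> x i) * \<psi> x"
  let ?d = "\<lambda>k. 1 / lambda1 (M k) - 1 / lambda1 (M (Suc k))"
  {
    assume bt: "\<forall>k\<in>{1..<N}. bathtub (lebesgue_on \<Omega>) \<psi> (\<alpha> k) (\<lambda>x. \<Sum>i=1..k. \<theta> x i)"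
    have "objective \<Omega> N M \<psi> \<theta>' \<le> objective \<Omega> N M \<psi> \<theta>" if \<theta>': "\<theta>' \<in> designs \<Omega> N q" for \<theta>'
      unfolding objective_eq[OF \<theta>] objective_eq[OF \<theta>'] using bt
      by (intro add_left_mono sum_mono mult_left_mono partial_bathtub_optimal(1)[OF \<theta> \<theta>']
          less_imp_le[OF weight_pos]) auto
    then show "optimal_design \<Omega> N M q \<psi> \<theta>" using \<theta> by (simp add: optimal_design_def)
  next
    assume opt: "optimal_design \<Omega> N M q \<psi> \<theta>"
    obtain \<eta> where \<eta>: "\<eta> \<in> designs \<Omega> N q"
      and bt: "\<forall>k\<in>{1..<N}. bathtub (lebesgue_on \<Omega>) \<psi> (\<alpha> k) (\<lambda>x. \<Sum>i=1..k. \<eta> x i)"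
      using ex_bathtub_design by blast
    have le: "?I \<theta> k \<le> ?I \<eta> k" if "k \<in> {1..<N}" for k
      using bt that by (intro partial_bathtub_optimal(1)[OF \<eta> \<theta>]) auto
    have le': "?d k * ?I \<theta> k \<le> ?d k * ?I \<eta> k" if "k \<in> {1..<N}" for k
      using le[OF that] weight_pos[OF that] by (intro mult_left_mono) auto
    have "objective \<Omega> N M \<psi> \<eta> \<le> objective \<Omega> N M \<psi> \<theta>" using opt \<eta> by (simp add: optimal_design_def)
    then have "(\<Sum>k=1..<N. ?d k * ?I \<eta> k) \<le> (\<Sum>k=1..<N. ?d k * ?I \<theta> k)"
      unfolding objective_eq[OF \<theta>] objective_eq[OF \<eta>] by simp
    moreover have "(\<Sum>k=1..<N. ?d k * ?I \<theta> k) \<le> (\<Sum>k=1..<N. ?d k * ?I \<eta> k)"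
      using le' by (rule sum_mono)
    ultimately have sum_eq: "(\<Sum>k=1..<N. ?d k * ?I \<theta> k) = (\<Sum>k=1..<N. ?d k * ?I \<eta> k)" by simp
    show "\<forall>k\<in>{1..<N}. bathtub (lebesgue_on \<Omega>) \<psi> (\<alpha> k) (\<lambda>x. \<Sum>i=1..k. \<theta> x i)"
    proof
      fix k assume k: "k \<in> {1..<N}"
      \<comment> \<open>Termwise inequalities between finite sums of equal value are equalities.
        Cancelling the positive weight leaves the equality case of the bathtub principle.\<close>
      have "?d k * ?I \<theta> k = ?d k * ?I \<eta> k"
        using sum_mono_inv[OF sum_eq le' k] by simp
      then have "?I \<theta> k = ?I \<eta> k" using weight_pos[OF k] by auto
      then show "bathtub (lebesgue_on \<Omega>) \<psi> (\<alpha> k) (\<lambda>x. \<Sum>i=1..k. \<theta> x i)"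
        using bt k by (intro partial_bathtub_optimal(2)[OF \<eta> \<theta> k]) auto
    qed
  }
qed

end

section \<open>Application to the density of the optimal flux\<close>

theorem theorem4p1:
  fixes \<Omega> :: "(real^'d) set"
    and N m :: nat
    and M :: "nat \<Rightarrow> real^'d^'d"
    and q w :: "nat \<Rightarrow> real"
    and f :: "nat \<Rightarrow> (real^'d \<Rightarrow> real) \<Rightarrow> real"
    and \<sigma>s :: "nat \<Rightarrow> real^'d \<Rightarrow> real^'d"
    and \<psi> :: "real^'d \<Rightarrow> real"
  assumes "open \<Omega>" and "bounded \<Omega>"
    and "N \<ge> 1" and "m \<ge> 1"
    and "\<forall>i\<in>{1..N}. symmetric_pos_def (M i)"
    and "\<forall>i\<in>{1..N}. q i \<ge> 0"
    and "\<forall>i\<in>{1..m}. f i \<in> H_minus1 \<Omega>"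
    and "\<forall>i\<in>{1..m}. w i > 0"
    and "(\<Sum>i=1..N. q i) = measure lebesgue \<Omega>"
    and "strict_mono_on {1..N} (\<lambda>i. lambda1 (M i))"
    and "optimal_flux \<Omega> N M q m w f \<sigma>s"
    and "\<psi> = (\<lambda>x. \<Sum>i=1..m. w i * (norm (\<sigma>s i x))\<^sup>2)"
  shows "integrable (lebesgue_on \<Omega>) \<psi>
    \<and> (\<forall>\<theta>\<in>designs \<Omega> N q. optimal_design \<Omega> N M q \<psi> \<theta> \<longrightarrow>
           (\<forall>k\<in>{1..N}. threshold_conditions \<Omega> q \<psi> \<theta> k))
    \<and> (\<forall>\<theta>\<in>designs \<Omega> N q. (\<forall>k\<in>{1..N}. threshold_conditions \<Omega> q \<psi> \<theta> k) \<longrightarrow>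
           optimal_design \<Omega> N M q \<psi> \<theta>)"
proof -
  obtain \<theta>s where "saddle_point \<Omega> N M q m w f \<theta>s \<sigma>s"
    using \<open>optimal_flux \<Omega> N M q m w f \<sigma>s\<close> by (auto simp: optimal_flux_def)
  \<comment> \<open>The flux of a saddle point is admissible, so its components are square
    integrable, and \<psi> is a finite combination of their squared norms.\<close>
  then have "\<forall>i\<in>{1..m}. integrable (lebesgue_on \<Omega>) (\<lambda>x. (norm (\<sigma>s i x))\<^sup>2)"
    by (auto simp: saddle_point_def fluxes_def L2_def)
  then have int: "integrable (lebesgue_on \<Omega>) \<psi>"
    unfolding assms(12) by (intro Bochner_Integration.integrable_sum integrable_mult_right) auto
  interpret nested_bathtub \<Omega> N M q \<psi>
  proof
    show "\<Omega> \<in> lmeasurable" using assms(1,2) by (simp add: lmeasurable_open)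
    show "0 \<le> \<psi> x" for x
      unfolding assms(12) using assms(8) by (intro sum_nonneg mult_nonneg_nonneg) (auto intro: less_imp_le)
    show "0 < lambda1 (M i)" if "i \<in> {1..N}" for i
      using assms(5) that by (intro lambda1_pos) blast
  qed (use assms(3,6,9,10) int in auto)
  show ?thesis using int optimal_design_iff by blast
qed

end
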